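(* Let $q$ be a prime power, $n>1$ an integer and $d_1, \ldots, d_k$ distinct positive divisors of $n$. Fix $(\beta_1, \ldots, \beta_k)\in \prod_{i=1}^k\mathbb{F}_{q^{d_i}}$ such that $\mathrm{Tr}_{d_i/\gcd(d_i, d_j)}(\beta_i)=\mathrm{Tr}_{d_j/\gcd(d_i, d_j)}(\beta_j)$ for all $1\le i<j\le k$, and consider the system $$\mathrm{Tr}_{n/d_i}(x)=\beta_i,\quad 1\le i\le k,$$ in the unknown $x\in\mathbb{F}_{q^n}$. Then this system has exactly $q^{n-\lambda(d_1, \ldots, d_k)}$ solutions in $\mathbb{F}_{q^n}$, where $$\lambda(d_1, \ldots, d_k)=\sum_{i=1}^kd_i+\sum_{j=2}^{k}(-1)^{j+1}\sum_{1\le i_1<\cdots<i_j\le k}\gcd(d_{i_1}, \ldots, d_{i_j}).$$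
   Context: For positive integers $m\mid N$, the trace map $\mathrm{Tr}_{N/m}:\mathbb{F}_{q^N}\to\mathbb{F}_{q^m}$ is $\alpha\mapsto\sum_{j=0}^{N/m-1}\alpha^{q^{mj}}$ (the identity when $m=N$). *)

theory Defs
  imports "HOL-Algebra.Algebra" "HOL-Number_Theory.Prime_Powers"
begin

text \<open>The trace map from \<open>F\<^bsub>q^N\<^esub>\<close> to \<open>F\<^bsub>q^m\<^esub>\<close>, for \<open>m\<close> dividing \<open>N\<close>. Both fields are regarded as
  subfields of one ambient field \<open>K\<close>, in which the sum and the powers are computed; the formula is
  meaningful on the elements of the subfield of order \<open>q^N\<close>.\<close>

definition trace_map :: "('a, 'b) ring_scheme \<Rightarrow> nat \<Rightarrow> nat \<Rightarrow> nat \<Rightarrow> 'a \<Rightarrow> 'a" where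
  "trace_map K q N m \<alpha> = (\<Oplus>\<^bsub>K\<^esub>j\<in>{..<N div m}. \<alpha> [^]\<^bsub>K\<^esub> (q ^ (m * j)))"

text \<open>The index tuples \<open>i\<^sub>1 < \<dots> < i\<^sub>j\<close> in \<open>{1..k}\<close> are encoded as the subsets of \<open>{1..k}\<close> with \<open>j\<close>
  elements. The values are integers because of the alternating signs.\<close>

definition lambda_gcd :: "nat \<Rightarrow> (nat \<Rightarrow> nat) \<Rightarrow> int" where
  "lambda_gcd k d =
     (\<Sum>i\<in>{1..k}. int (d i)) +
     (\<Sum>j\<in>{2..k}. (-1) ^ (j + 1) * (\<Sum>I\<in>{I. I \<subseteq> {1..k} \<and> card I = j}. int (Gcd (d ` I))))"

end

theory Submission
  imports Defs "HOL-Number_Theory.Cong"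
begin

text \<open>A solution exists by induction on the set of conditions, the condition with the largest
  \<open>p\<close>-adic valuation of \<open>d k\<close> coming last. If \<open>x\<close> solves the others, then
  \<open>\<gamma> = \<beta> k - Tr\<^bsub>n/d k\<^esub> x\<close> has trace \<open>0\<close> down to every \<open>F\<^bsub>q^gcd (d k) (d i)\<^esub>\<close>. All \<open>d i\<close> divide some
  \<open>N\<close> dividing \<open>n\<close> such that \<open>N div d k\<close> is prime to \<open>p\<close>; hence \<open>\<gamma>\<close> divided by \<open>N div d k\<close> has trace \<open>\<gamma>\<close>
  in \<open>F\<^bsub>q^(d k)\<^esub>\<close> and trace \<open>0\<close> in the other \<open>F\<^bsub>q^(d i)\<^esub>\<close>, and it lifts through the surjective trace
  from \<open>F\<^bsub>q^n\<^esub>\<close> to \<open>F\<^bsub>q^N\<^esub>\<close>.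

  The solutions form a coset of the solutions of the homogeneous system. By solvability, the trace
  to \<open>F\<^bsub>q^(d k)\<^esub>\<close> maps the homogeneous solutions for the other indices onto the homogeneous
  solutions in \<open>F\<^bsub>q^(d k)\<^esub>\<close> for the numbers \<open>gcd (d k) (d i)\<close>. Thus the codimension satisfies the
  recursion \<open>\<lambda>(d\<^sub>1, \<dots>, d\<^sub>k) = \<lambda>(d\<^sub>1, \<dots>, d\<^sub>k\<^sub>-\<^sub>1) + d\<^sub>k - \<lambda>(gcd d\<^sub>1 d\<^sub>k, \<dots>, gcd d\<^sub>k\<^sub>-\<^sub>1 d\<^sub>k)\<close> of
  inclusion-exclusion.\<close>

\<comment> \<open>Otherwise \<open>[k] \<cdot> x\<close> also parses as a product of ideals.\<close>
no_notation ideal_prod (infixl \<open>\<cdot>\<index>\<close> 80)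

section \<open>The Frobenius map in characteristic p\<close>

context cring
begin

lemma binomial:
  assumes x: "x \<in> carrier R" and y: "y \<in> carrier R"
  shows "(x \<oplus> y) [^] (n::nat) = (\<Oplus>k\<in>{..n}. [(n choose k)] \<cdot> (x [^] k \<otimes> y [^] (n - k)))"
proof (induction n)
  case 0
  then show ?case using x y by simp
next
  case (Suc n)
  let ?t = "\<lambda>m k. [(n choose k)] \<cdot> (x [^] k \<otimes> y [^] (m - k))"
  let ?u = "\<lambda>k. x [^] Suc k \<otimes> y [^] (n - k)"
  have c: "?t m k \<in> carrier R" "[j] \<cdot> ?u k \<in> carrier R" for m k and j :: nat
    using x y by auto
  have "(x \<oplus> y) [^] Suc n = (\<Oplus>k\<in>{..n}. ?t n k) \<otimes> x \<oplus> (\<Oplus>k\<in>{..n}. ?t n k) \<otimes> y"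
    using x y Suc.IH by (simp add: r_distr Pi_def)
  also have "(\<Oplus>k\<in>{..n}. ?t n k) \<otimes> x = (\<Oplus>k\<in>{..n}. ?t n k \<otimes> x)"
    using x c by (simp add: finsum_ldistr Pi_def)
  also have "\<dots> = (\<Oplus>k\<in>{..n}. [(n choose k)] \<cdot> ?u k)"
    using x y by (intro finsum_cong') (auto simp: add_pow_ldistr add_pow_rdistr m_ac)
  also have "(\<Oplus>k\<in>{..n}. ?t n k) \<otimes> y = (\<Oplus>k\<in>{..n}. ?t n k \<otimes> y)"
    using y c by (simp add: finsum_ldistr Pi_def)
  also have "\<dots> = (\<Oplus>k\<in>{..n}. ?t (Suc n) k)"
    using x y by (intro finsum_cong') (auto simp: add_pow_ldistr m_assoc Suc_diff_le)
  \<comment> \<open>The added term vanishes because \<open>n choose Suc n = 0\<close>. Splitting off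
    index 0 next leaves a shifted sum over \<open>{..n}\<close> that can be merged with the other
    one by Pascal's rule.\<close>
  also have "\<dots> = (\<Oplus>k\<in>{..Suc n}. ?t (Suc n) k)"
    using x y c by (subst finsum_Suc) (auto simp: binomial_eq_0)
  also have "\<dots> = (\<Oplus>k\<in>{..n}. [(n choose Suc k)] \<cdot> ?u k) \<oplus> y [^] Suc n"
    using x y by (subst finsum_Suc2) auto
  also have "(\<Oplus>k\<in>{..n}. [(n choose k)] \<cdot> ?u k) \<oplus> \<dots> =
      (\<Oplus>k\<in>{..n}. [(n choose k)] \<cdot> ?u k \<oplus> [(n choose Suc k)] \<cdot> ?u k) \<oplus> y [^] Suc n"
    using x y c by (subst finsum_addf) (auto simp: a_assoc Pi_def)
  also have "\<dots> = (\<Oplus>k\<in>{..n}. [(Suc n choose Suc k)] \<cdot> ?u k) \<oplus> y [^] Suc n"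
  proof -
    have "[(n choose k)] \<cdot> ?u k \<oplus> [(n choose Suc k)] \<cdot> ?u k = [(Suc n choose Suc k)] \<cdot> ?u k" for k
      using x y by (subst add.nat_pow_mult) auto
    then show ?thesis by (simp only:)
  qed
  also have "\<dots> = (\<Oplus>k\<in>{..Suc n}. [(Suc n choose k)] \<cdot> (x [^] k \<otimes> y [^] (Suc n - k)))"
    using x y by (subst finsum_Suc2) auto
  finally show ?case .
qed

lemma frobenius_add:
  assumes p: "Factorial_Ring.prime (p::nat)" and char: "[p] \<cdot> \<one> = \<zero>" and x: "x \<in> carrier R" and y: "y \<in> carrier R"
  shows "(x \<oplus> y) [^] p = x [^] p \<oplus> y [^] p"
proof -
  have z: "[p] \<cdot> a = \<zero>" if "a \<in> carrier R" for a
    using add_pow_ldistr[of \<one> a p] char that by simp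
  have mid: "[(p choose k)] \<cdot> a = \<zero>" if a: "a \<in> carrier R" and k: "0 < k" "k < p" for a k
  proof -
    obtain c where "p choose k = p * c"
      using dvd_choose_prime[of k p] p k by (auto simp: dvd_def)
    then show ?thesis using a z by (simp flip: add.nat_pow_pow)
  qed
  \<comment> \<open>In this form the two outer terms can be split off, and the inner ones are
    indexed by \<open>{..r}\<close>, all with binomial coefficients divisible by
    \<open>p\<close>.\<close>
  obtain r where r: "p = Suc (Suc r)" using p prime_ge_2_nat[OF p] by (metis add_2_eq_Suc le_Suc_ex)
  let ?t = "\<lambda>k. [(p choose k)] \<cdot> (x [^] k \<otimes> y [^] (p - k))"
  have c: "?t k \<in> carrier R" for k using x y by auto
  have "(x \<oplus> y) [^] p = (\<Oplus>k\<in>{..Suc (Suc r)}. ?t k)" using binomial[OF x y, of p] r by simp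
  also have "\<dots> = ?t (Suc (Suc r)) \<oplus> ((\<Oplus>k\<in>{..r}. ?t (Suc k)) \<oplus> ?t 0)"
    using c by (subst finsum_Suc, simp, subst finsum_Suc2) (simp_all add: Pi_def)
  also have "(\<Oplus>k\<in>{..r}. ?t (Suc k)) = \<zero>"
    using x y r by (intro add.finprod_one_eqI mid) auto
  finally show ?thesis using x y c r by (simp del: nat_pow_Suc binomial_Suc_Suc)
qed

lemma frobenius_pow_add:
  assumes p: "Factorial_Ring.prime (p::nat)" and char: "[p] \<cdot> \<one> = \<zero>" and x: "x \<in> carrier R" and y: "y \<in> carrier R"
  shows "(x \<oplus> y) [^] (p ^ m) = x [^] (p ^ m) \<oplus> y [^] (p ^ m)"
proof (induction m)
  case (Suc m)
  have "(x \<oplus> y) [^] (p ^ Suc m) = ((x \<oplus> y) [^] (p ^ m)) [^] p"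
    using x y by (simp add: nat_pow_pow mult.commute)
  also have "\<dots> = (x [^] (p ^ m)) [^] p \<oplus> (y [^] (p ^ m)) [^] p"
    using x y Suc.IH frobenius_add[OF p char] by simp
  finally show ?case using x y by (simp add: nat_pow_pow mult.commute)
qed (use x y in simp)

end

section \<open>Additive maps and regrouping of finite sums\<close>

context abelian_group
begin

lemma hom_minus:
  assumes f: "f \<in> carrier G \<rightarrow> carrier G"
    and add: "\<And>x y. x \<in> carrier G \<Longrightarrow> y \<in> carrier G \<Longrightarrow> f (x \<oplus> y) = f x \<oplus> f y"
    and x: "x \<in> carrier G" and y: "y \<in> carrier G"
  shows "f (x \<ominus> y) = f x \<ominus> f y"
proof -
  have "f (x \<ominus> y) \<oplus> f y = f ((x \<ominus> y) \<oplus> y)" using add x y by simp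
  also have "(x \<ominus> y) \<oplus> y = x" using x y by (simp add: minus_eq a_assoc l_neg)
  finally have "f x = f (x \<ominus> y) \<oplus> f y" by simp
  then show ?thesis using f x y by (simp add: minus_eq a_assoc r_neg Pi_def)
qed

text \<open>Every nonempty fibre of \<open>f\<close> on \<open>A\<close> is a translate of the
  kernel. The formula stands in for rank-nullity, with orders instead of dimensions.\<close>

lemma card_eq_card_image_times_card_kernel:
  assumes A: "additive_subgroup A G" and fin: "finite A"
    and f: "f \<in> A \<rightarrow> carrier G"
    and add: "\<And>x y. x \<in> A \<Longrightarrow> y \<in> A \<Longrightarrow> f (x \<oplus> y) = f x \<oplus> f y"
  shows "card A = card (f ` A) * card {x \<in> A. f x = \<zero>}"
proof -
  interpret A: additive_subgroup A G by fact
  have fib: "card {x \<in> A. f x = b} = card {x \<in> A. f x = \<zero>}" if "b \<in> f ` A" for b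
  proof -
    from that obtain a where a: "a \<in> A" "b = f a" by blast
    have neg: "\<ominus> a \<in> A" using a(1) by (rule A.a_inv_closed)
    have c: "x \<in> carrier G" if "x \<in> A" for x using that by (rule A.a_Hcarr)
    have fc: "f x \<in> carrier G" if "x \<in> A" for x using that f by (rule funcset_mem[rotated])
    have cancel: "\<ominus> a \<oplus> (a \<oplus> x) = x" "a \<oplus> (\<ominus> a \<oplus> x) = x" if "x \<in> A" for x
      using c[OF a(1)] c[OF that] by (simp_all add: r_neg1 r_neg2)
    have to_fibre: "a \<oplus> x \<in> {x \<in> A. f x = b}" if "x \<in> A" "f x = \<zero>" for x
    proof -
      have "f (a \<oplus> x) = f a" using add[OF a(1) that(1)] that(2) fc[OF a(1)] by simp
      then show ?thesis using A.a_closed[OF a(1) that(1)] a(2) by simp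
    qed
    have to_kernel: "\<ominus> a \<oplus> x \<in> {x \<in> A. f x = \<zero>}" if "x \<in> A" "f x = b" for x
    proof -
      have m: "\<ominus> a \<oplus> x \<in> A" using A.a_closed[OF neg that(1)] .
      have "f a \<oplus> f (\<ominus> a \<oplus> x) = f a"
        using add[OF a(1) m] unfolding cancel(2)[OF that(1)] that(2) a(2) by (rule sym)
      then have "f (\<ominus> a \<oplus> x) = \<zero>" using fc[OF a(1)] fc[OF m] by (metis add.l_cancel_one)
      then show ?thesis using m by simp
    qed
    have "bij_betw (\<lambda>x. a \<oplus> x) {x \<in> A. f x = \<zero>} {x \<in> A. f x = b}"
      by (rule bij_betw_byWitness[where f' = "\<lambda>x. \<ominus> a \<oplus> x"])
        (use cancel to_fibre to_kernel in blast)+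
    then show ?thesis by (rule bij_betw_same_card[symmetric])
  qed
  have "A = (\<Union>b\<in>f ` A. {x \<in> A. f x = b})" by auto
  then have "card A = card (\<Union>b\<in>f ` A. {x \<in> A. f x = b})" by (rule arg_cong[where f = card])
  also have "\<dots> = (\<Sum>b\<in>f ` A. card {x \<in> A. f x = b})"
    using fin by (intro card_UN_disjoint) auto
  also have "\<dots> = (\<Sum>b\<in>f ` A. card {x \<in> A. f x = \<zero>})" using fib by (rule sum.cong[OF refl])
  finally show ?thesis by simp
qed

end

context abelian_monoid
begin

lemma finsum_mult_nested:
  assumes "\<And>i. f i \<in> carrier G"
  shows "(\<Oplus>j\<in>{..<a * b :: nat}. f j) = (\<Oplus>i\<in>{..<b}. \<Oplus>j\<in>{..<a}. f (j + a * i))"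
proof (induction b)
  case (Suc b)
  have "{..<a * Suc b} = {..<a * b} \<union> (\<lambda>j. j + a * b) ` {..<a}"
    using lessThan_atLeast0 image_add_atLeastLessThan'[of "a * b" 0 a] ivl_disj_un_one(2)[of "a * b" "a * Suc b"]
    by (simp add: add.commute)
  then have "(\<Oplus>j\<in>{..<a * Suc b}. f j) = (\<Oplus>j\<in>{..<a * b}. f j) \<oplus> (\<Oplus>j\<in>(\<lambda>j. j + a * b) ` {..<a}. f j)"
    using assms by (simp only:) (subst finsum_Un_disjoint; auto)
  also have "(\<Oplus>j\<in>(\<lambda>j. j + a * b) ` {..<a}. f j) = (\<Oplus>j\<in>{..<a}. f (j + a * b))"
    using assms by (subst finsum_reindex) auto
  finally show ?case
    using assms Suc.IH by (simp add: lessThan_Suc a_comm)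
qed simp

end

text \<open>Both sides are the sum over \<open>{..r}\<close>. In a group, if
  \<open>f r = f 0\<close>, the outer terms cancel and the sum is invariant under the shift.\<close>

lemma (in abelian_monoid) finsum_lessThan_shift:
  assumes "f \<in> UNIV \<rightarrow> carrier G"
  shows "(\<Oplus>j\<in>{..<r::nat}. f (Suc j)) \<oplus> f 0 = (\<Oplus>j\<in>{..<r}. f j) \<oplus> f r"
proof -
  have "(\<Oplus>j\<in>{..<r}. f j) \<oplus> f r = (\<Oplus>j\<in>{..r}. f j)"
    using assms by (simp add: add.finprod_Suc3 a_comm Pi_def)
  also have "\<dots> = (\<Oplus>j\<in>{..<r}. f (Suc j)) \<oplus> f 0"
  proof (cases r)
    case (Suc s)
    then show ?thesis using assms by (simp del: finsum_Suc add: finsum_Suc2 lessThan_Suc_atMost Pi_def)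
  qed (use assms in \<open>simp add: Pi_def\<close>)
  finally show ?thesis by simp
qed

section \<open>Root counting and Fermat's little theorem in finite fields\<close>

lemma (in domain) card_roots_sum_monoms_le:
  assumes fin: "finite (carrier R)" and g: "strict_mono (g :: nat \<Rightarrow> nat)"
  shows "card {x \<in> carrier R. (\<Oplus>j\<in>{..<Suc r}. x [^] g j) = \<zero>} \<le> g r"
proof -
  interpret U: UP_domain R "UP R" by unfold_locales
  let ?f = "\<Oplus>\<^bsub>UP R\<^esub>j\<in>{..<Suc r}. up_ring.monom (UP R) \<one> (g j)"
  have f: "?f \<in> carrier (UP R)" by (intro U.P.finsum_closed) auto
  have coeff: "up_ring.coeff (UP R) ?f k = (\<Oplus>j\<in>{..<Suc r}. if g j = k then \<one> else \<zero>)" for k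
    by (subst U.coeff_finsum) (auto intro!: finsum_cong')
  \<comment> \<open>The exponents \<open>g j\<close> are distinct, so only \<open>j = r\<close>
    contributes: the coefficient is one, not a multiple of one that could vanish in positive
    characteristic.\<close>
  have "up_ring.coeff (UP R) ?f (g r) = (\<Oplus>j\<in>{..<Suc r}. if r = j then \<one> else \<zero>)"
    unfolding coeff using strict_mono_eq[OF g] by (intro finsum_cong') auto
  also have "\<dots> = \<one>" by (subst finsum_singleton) auto
  finally have "?f \<noteq> \<zero>\<^bsub>UP R\<^esub>" by auto
  moreover have "UnivPoly.deg R ?f \<le> g r"
  proof (rule U.deg_aboveI)
    fix m assume "g r < m"
    then have "g j \<noteq> m" if "j < Suc r" for j
      using that strict_mono_less_eq[OF g, of j r] by auto
    then show "up_ring.coeff (UP R) ?f m = \<zero>"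
      unfolding coeff by (intro add.finprod_one_eqI) auto
  qed fact
  moreover have "UnivPoly.eval R R id x ?f = (\<Oplus>j\<in>{..<Suc r}. x [^] g j)" if x: "x \<in> carrier R" for x
  proof -
    interpret UP_pre_univ_prop R R id "UP R" by unfold_locales simp_all
    interpret h: ring_hom_cring "UP R" R "UnivPoly.eval R R id x" by unfold_locales (rule eval_ring_hom[OF x])
    have "UnivPoly.eval R R id x ?f = (\<Oplus>j\<in>{..<Suc r}. (UnivPoly.eval R R id x \<circ> (\<lambda>j. up_ring.monom (UP R) \<one> (g j))) j)"
      by (subst h.hom_finsum) (auto simp: comp_def)
    then show ?thesis using x by (simp add: comp_def U.evalRR_monom[unfolded id_def] eval_monom)
  qed
  ultimately show ?thesis
    using U.roots_bound[OF f _ fin] by (auto simp: cong: conj_cong)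
qed

lemma (in field) pow_card_eq_self:
  assumes fin: "finite (carrier R)" and x: "x \<in> carrier R"
  shows "x [^] card (carrier R) = x"
proof (cases "x = \<zero>")
  case True
  have "card (carrier R) \<noteq> 0" using fin x by auto
  then show ?thesis using True by (simp add: nat_pow_zero)
next
  case False
  have pos: "card (carrier R) > 0" using fin x by (auto simp: card_gt_0_iff)
  interpret M: group "Multiplicative_Group.mult_of R" by (rule field_mult_group)
  have "x [^] (card (carrier R) - 1) = \<one>"
    using M.pow_order_eq_1[of x] False x fin
    by (simp add: order_mult_of order_def Multiplicative_Group.nat_pow_mult_of)
  then have "x [^] Suc (card (carrier R) - 1) = x" using x by simp
  then show ?thesis using pos by (simp del: nat_pow_Suc)
qed

section \<open>Frobenius powers and their fixed fields\<close>

locale finite_field = field K for K (structure) +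
  fixes p e n :: nat
  assumes prime_p: "Factorial_Ring.prime p" and e_pos: "0 < e" and n_pos: "0 < n"
    and card_carrier: "card (carrier K) = (p ^ e) ^ n"
begin

abbreviation q :: nat where "q \<equiv> p ^ e"

definition frob :: "nat \<Rightarrow> 'a \<Rightarrow> 'a" where
  "frob m x = x [^] (q ^ m)"

text \<open>For \<open>m\<close> dividing \<open>n\<close> this is the subfield F_(q^m) of
  \<open>K\<close>. Defining it by the Frobenius equation turns membership into a computation with
  powers.\<close>

definition fixed_field :: "nat \<Rightarrow> 'a set" where
  "fixed_field m = {x \<in> carrier K. frob m x = x}"

abbreviation Tr :: "nat \<Rightarrow> nat \<Rightarrow> 'a \<Rightarrow> 'a" where
  "Tr \<equiv> trace_map K q"

lemma p_gt_1: "1 < p"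
  using prime_p by (rule prime_gt_1_nat)

lemma q_gt_1: "1 < q"
  using p_gt_1 e_pos by (rule one_less_power)

lemma finite_carrier: "finite (carrier K)"
  using card_carrier p_gt_1 by (intro card_ge_0_finite) simp

text \<open>By Lagrange in the additive group, \<open>p ^ (e * n)\<close> times one is zero. This
  multiple is a power of \<open>[p] \<cdot> \<one>\<close>, and a field has no nonzero
  nilpotents.\<close>

lemma char: "[p] \<cdot> \<one> = \<zero>"
proof -
  have pow: "([p] \<cdot> \<one>) [^] m = [(p ^ m)] \<cdot> \<one>" for m
  proof (induction m)
    case (Suc m)
    then have "([p] \<cdot> \<one>) [^] Suc m = [(p ^ m)] \<cdot> ([p] \<cdot> \<one>)"
      by (simp add: add_pow_ldistr)
    then show ?case by (simp add: add.nat_pow_pow)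
  qed simp
  have "order (add_monoid K) = p ^ (e * n)"
    using card_carrier by (simp add: order_def power_mult)
  then have "[(p ^ (e * n))] \<cdot> \<one> = \<zero>"
    using add.pow_order_eq_1[of \<one>] by simp
  then have "([p] \<cdot> \<one>) [^] (e * n) = \<zero>"
    by (simp add: pow)
  moreover have "x = \<zero>" if "x \<in> carrier K" "x [^] (m::nat) = \<zero>" for x m
    using that by (induction m) (auto simp: integral_iff)
  ultimately show ?thesis by auto
qed

lemma frob_closed [simp]: "x \<in> carrier K \<Longrightarrow> frob m x \<in> carrier K"
  by (simp add: frob_def)

lemma frob_add:
  assumes "x \<in> carrier K" "y \<in> carrier K"
  shows "frob m (x \<oplus> y) = frob m x \<oplus> frob m y"
  unfolding frob_def power_mult[symmetric] using prime_p char assms by (rule frobenius_pow_add)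

lemma frob_zero [simp]: "frob m \<zero> = \<zero>"
  using p_gt_1 by (simp add: frob_def nat_pow_zero)

lemma frob_0 [simp]: "x \<in> carrier K \<Longrightarrow> frob 0 x = x"
  by (simp add: frob_def)

lemma frob_frob: "x \<in> carrier K \<Longrightarrow> frob a (frob b x) = frob (a + b) x"
  by (simp add: frob_def nat_pow_pow power_add mult.commute)

lemma frob_n: "x \<in> carrier K \<Longrightarrow> frob n x = x"
  using pow_card_eq_self[OF finite_carrier] card_carrier by (simp add: frob_def)

lemma frob_finsum:
  "f \<in> A \<rightarrow> carrier K \<Longrightarrow> frob m (\<Oplus>i\<in>A. f i) = (\<Oplus>i\<in>A. frob m (f i))"
  by (induction A rule: infinite_finite_induct) (auto simp: frob_add Pi_def)

lemma fixed_field_closed: "x \<in> fixed_field m \<Longrightarrow> x \<in> carrier K"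
  by (simp add: fixed_field_def)

lemma fixed_field_n: "fixed_field n = carrier K"
  by (auto simp: fixed_field_def frob_n)

lemma finite_fixed_field: "finite (fixed_field m)"
  using finite_carrier by (simp add: fixed_field_def)

lemma zero_fixed_field [simp]: "\<zero> \<in> fixed_field m"
  by (simp add: fixed_field_def)

lemma fixed_field_add:
  "x \<in> fixed_field m \<Longrightarrow> y \<in> fixed_field m \<Longrightarrow> x \<oplus> y \<in> fixed_field m"
  by (simp add: fixed_field_def frob_add)

lemma fixed_field_minus:
  assumes "x \<in> fixed_field m" "y \<in> fixed_field m"
  shows "x \<ominus> y \<in> fixed_field m"
proof -
  have "frob m (x \<ominus> y) = frob m x \<ominus> frob m y"
    using assms by (intro hom_minus) (auto simp: frob_add fixed_field_closed)
  then show ?thesis using assms by (simp add: fixed_field_def)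
qed

lemma frob_mult_fixed:
  assumes "x \<in> fixed_field m"
  shows "frob (m * k) x = x"
proof (induction k)
  case (Suc k)
  then show ?case
    using assms frob_frob[of x m "m * k"] by (simp add: fixed_field_def)
qed (use assms in \<open>simp add: fixed_field_def\<close>)

lemma fixed_field_mono:
  assumes "m dvd N" shows "fixed_field m \<subseteq> fixed_field N"
  using assms frob_mult_fixed by (auto elim!: dvdE simp: fixed_field_def)

lemma frob_mod_fixed:
  assumes "x \<in> fixed_field m"
  shows "frob (a mod m) x = frob a x"
proof -
  have "frob a x = frob (a mod m) (frob (m * (a div m)) x)"
    using assms by (simp add: frob_frob fixed_field_closed)
  then show ?thesis using assms by (simp add: frob_mult_fixed)
qed

section \<open>Trace maps: invariance and transitivity\<close>

lemma Tr_def: "Tr N m x = (\<Oplus>j\<in>{..<N div m}. frob (m * j) x)"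
  by (simp add: trace_map_def frob_def)

lemma Tr_closed [simp]: "x \<in> carrier K \<Longrightarrow> Tr N m x \<in> carrier K"
  by (simp add: Tr_def Pi_def)

lemma Tr_add:
  "x \<in> carrier K \<Longrightarrow> y \<in> carrier K \<Longrightarrow> Tr N m (x \<oplus> y) = Tr N m x \<oplus> Tr N m y"
  by (simp add: Tr_def frob_add finsum_addf Pi_def)

lemma Tr_minus:
  "x \<in> carrier K \<Longrightarrow> y \<in> carrier K \<Longrightarrow> Tr N m (x \<ominus> y) = Tr N m x \<ominus> Tr N m y"
  by (intro hom_minus) (auto simp: Tr_add)

lemma Tr_zero [simp]: "Tr N m \<zero> = \<zero>"
  by (simp add: Tr_def)

lemma Tr_frob:
  "x \<in> carrier K \<Longrightarrow> Tr N m (frob a x) = frob a (Tr N m x)"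
  by (simp add: Tr_def frob_finsum frob_frob Pi_def add.commute)

text \<open>On \<open>fixed_field N\<close> the summands have period \<open>N div m\<close> in
  \<open>j\<close>, so \<open>frob m\<close> only permutes them cyclically.\<close>

lemma Tr_shift:
  assumes m: "m dvd N" and x: "x \<in> fixed_field N"
  shows "Tr N m (frob m x) = Tr N m x"
proof -
  let ?f = "\<lambda>j. frob (m * j) x"
  have xc: "x \<in> carrier K" using x by (rule fixed_field_closed)
  have "?f (N div m) = x" using x m by (simp add: fixed_field_def)
  then have eq: "Tr N m (frob m x) \<oplus> x = Tr N m x \<oplus> x"
    using finsum_lessThan_shift[of ?f "N div m"] xc
    by (simp add: Tr_def frob_frob Pi_def add.commute)
  show ?thesis using add.r_cancel[OF eq] xc by simp
qed

lemma Tr_in_fixed_field: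
  assumes "m dvd N" "x \<in> fixed_field N"
  shows "Tr N m x \<in> fixed_field m"
  using Tr_shift[OF assms] assms by (simp add: fixed_field_def Tr_frob)

text \<open>With \<open>m = l * a\<close> and \<open>N = m * b\<close>, the exponents are
  \<open>l * j + m * i\<close> for \<open>j < a\<close> and \<open>i < b\<close>. Summing over
  \<open>j\<close> first yields the traces in the opposite order; they commute because they are sums
  of Frobenius powers.\<close>

lemma Tr_trans:
  assumes "l dvd m" "m dvd N" "0 < m" "x \<in> carrier K"
  shows "Tr m l (Tr N m x) = Tr N l x"
proof -
  obtain a where a: "m = l * a" using assms by (auto elim: dvdE)
  obtain b where b: "N = m * b" using assms by (auto elim: dvdE)
  have pos: "0 < l" "0 < a" using a assms by auto
  have "Tr N l x = (\<Oplus>j\<in>{..<a * b}. frob (l * j) x)"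
    using a b pos by (simp add: Tr_def)
  also have "\<dots> = (\<Oplus>i\<in>{..<b}. \<Oplus>j\<in>{..<a}. frob (l * (j + a * i)) x)"
    using assms by (intro finsum_mult_nested) simp
  also have "\<dots> = (\<Oplus>i\<in>{..<b}. frob (m * i) (Tr m l x))"
    using assms a b pos
    by (intro finsum_cong') (auto simp: Tr_def frob_finsum frob_frob Pi_def algebra_simps)
  also have "\<dots> = Tr N m (Tr m l x)"
    using b assms by (simp add: Tr_def)
  also have "\<dots> = (\<Oplus>j\<in>{..<a}. Tr N m (frob (l * j) x))"
  proof -
    have "Tr N m (\<Oplus>j\<in>A. f j) = (\<Oplus>j\<in>A. Tr N m (f j))" if "f \<in> A \<rightarrow> carrier K" for f and A :: "nat set"
      using that by (induction A rule: infinite_finite_induct) (auto simp: Tr_add Pi_def)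
    from this[of "\<lambda>j. frob (l * j) x" "{..<a}"] have
      "Tr N m (\<Oplus>j\<in>{..<a}. frob (l * j) x) = (\<Oplus>j\<in>{..<a}. Tr N m (frob (l * j) x))"
      using assms by simp
    moreover have "Tr m l x = (\<Oplus>j\<in>{..<a}. frob (l * j) x)"
      using a pos by (simp add: Tr_def)
    ultimately show ?thesis by simp
  qed
  also have "\<dots> = Tr m l (Tr N m x)"
    unfolding Tr_def[of m l] using a pos assms by (simp add: Tr_frob)
  finally show ?thesis by simp
qed

section \<open>Orders of the subfields and surjectivity of the trace\<close>

lemma additive_subgroup_fixed_field: "additive_subgroup (fixed_field m) K"
proof (rule additive_subgroup.intro, rule add.subgroupI)
  fix x assume "x \<in> fixed_field m"
  then show "\<ominus> x \<in> fixed_field m"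
    using fixed_field_minus[of \<zero> m x] by (simp add: minus_eq fixed_field_closed)
qed (auto simp: fixed_field_closed fixed_field_add intro: zero_fixed_field)

lemma card_kernel_Tr_le:
  assumes N: "N dvd n"
  shows "card {x \<in> carrier K. Tr n N x = \<zero>} \<le> q ^ (n - N)"
proof -
  obtain r where r: "n = N * r" using N by (auto elim: dvdE)
  have "0 < N" "0 < r" using r n_pos by auto
  then obtain s where s: "r = Suc s" by (cases r) auto
  have "strict_mono (\<lambda>j. q ^ (N * j))"
    using q_gt_1 \<open>0 < N\<close> by (intro strict_monoI) (simp add: power_strict_increasing)
  \<comment> \<open>The trace is a polynomial in \<open>x\<close> with top exponent
    \<open>q ^ (N * s)\<close>, and \<open>N * s = n - N\<close>.\<close>
  from card_roots_sum_monoms_le[OF finite_carrier this, of s]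
  show ?thesis using r s \<open>0 < N\<close> by (simp add: trace_map_def algebra_simps)
qed

lemma card_fixed_field_le:
  assumes m: "0 < m"
  shows "card (fixed_field m) \<le> q ^ m"
proof -
  have q: "1 < q ^ m" using q_gt_1 m by (rule one_less_power)
  \<comment> \<open>The root bound concerns powers equal to one, so zero is counted
    separately.\<close>
  let ?R = "{x \<in> carrier K. x [^] (q ^ m - 1) = \<one>}"
  have "x [^] (q ^ m - 1) = \<one>" if "x \<in> fixed_field m" "x \<noteq> \<zero>" for x
  proof -
    have c: "x \<in> carrier K" using that by (simp add: fixed_field_closed)
    have "x [^] (q ^ m - 1) \<otimes> x = x [^] Suc (q ^ m - 1)" by simp
    also have "Suc (q ^ m - 1) = q ^ m" using q by simp
    also have "x [^] (q ^ m) = \<one> \<otimes> x" using that c by (simp add: fixed_field_def frob_def)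
    finally have "x [^] (q ^ m - 1) \<otimes> x = \<one> \<otimes> x" .
    then show ?thesis using m_rcancel[of x "x [^] (q ^ m - 1)" \<one>] c that by simp
  qed
  then have "fixed_field m \<subseteq> insert \<zero> ?R"
    by (auto simp: fixed_field_closed)
  then have "card (fixed_field m) \<le> card (insert \<zero> ?R)"
    using finite_carrier by (intro card_mono) auto
  also have "\<dots> \<le> Suc (card ?R)" by (rule card_insert_le_m1) auto
  also have "card ?R \<le> q ^ m - 1"
    using q finite_carrier by (intro num_roots_le_deg) auto
  finally show ?thesis using q by simp
qed

lemma
  assumes N: "N dvd n"
  shows card_fixed_field: "card (fixed_field N) = q ^ N"
    and Tr_image: "Tr n N ` carrier K = fixed_field N"
proof -
  have pos: "0 < N" and le: "N \<le> n" using N n_pos by (auto intro: Nat.gr0I dest: dvd_imp_le)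
  have split: "q ^ n = q ^ N * q ^ (n - N)" using le by (simp flip: power_add)
  have qpos: "0 < q ^ (n - N)" using p_gt_1 by simp
  have carr: "additive_subgroup (carrier K) K"
    using additive_subgroup_fixed_field[of n] by (simp add: fixed_field_n)
  \<comment> \<open>The trace vanishes on the image of \<open>frob N - 1\<close>, so the bound on its kernel bounds the size of
    \<open>ker (frob N - 1) = fixed_field N\<close> from below.\<close>
  let ?f = "\<lambda>x. frob N x \<ominus> x" and ?ker = "{x \<in> carrier K. Tr n N x = \<zero>}"
  have minus: "?f (x \<oplus> y) = ?f x \<oplus> ?f y" if "x \<in> carrier K" "y \<in> carrier K" for x y
    using that by (simp add: frob_add minus_eq minus_add a_ac)
  have "card (carrier K) = card (?f ` carrier K) * card {x \<in> carrier K. ?f x = \<zero>}"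
    using carr finite_carrier
    by (rule card_eq_card_image_times_card_kernel)
      (simp_all add: Pi_def minus)
  also have "{x \<in> carrier K. ?f x = \<zero>} = fixed_field N"
    by (auto simp: fixed_field_def)
  finally have *: "q ^ N * q ^ (n - N) = card (?f ` carrier K) * card (fixed_field N)"
    using card_carrier split by simp
  have "?f ` carrier K \<subseteq> ?ker"
    using N by (auto simp: Tr_minus Tr_shift fixed_field_n r_right_minus_eq)
  then have "card (?f ` carrier K) \<le> card ?ker"
    using finite_carrier by (intro card_mono) auto
  also have "\<dots> \<le> q ^ (n - N)" using N by (rule card_kernel_Tr_le)
  finally have "q ^ N * q ^ (n - N) \<le> card (fixed_field N) * q ^ (n - N)"
    unfolding * mult.commute[of "card (fixed_field N)"] by (rule mult_le_mono1)
  then have "q ^ N \<le> card (fixed_field N)" using qpos by (rule mult_right_le_imp_le)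
  then show card: "card (fixed_field N) = q ^ N"
    using card_fixed_field_le[OF pos] by simp
  \<comment> \<open>The kernel bound now forces the image to have at least \<open>q ^ N\<close>
    elements, the order of the subfield that contains it.\<close>
  have "card (carrier K) = card (Tr n N ` carrier K) * card ?ker"
    using carr finite_carrier
    by (rule card_eq_card_image_times_card_kernel) (auto simp: Tr_add)
  also have "\<dots> \<le> card (Tr n N ` carrier K) * q ^ (n - N)"
    using card_kernel_Tr_le[OF N] by (rule mult_le_mono2)
  finally have "card (fixed_field N) * q ^ (n - N) \<le> card (Tr n N ` carrier K) * q ^ (n - N)"
    unfolding card card_carrier split .
  then have "card (fixed_field N) \<le> card (Tr n N ` carrier K)"
    using qpos by (rule mult_right_le_imp_le)
  moreover have "Tr n N ` carrier K \<subseteq> fixed_field N"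
    using N Tr_in_fixed_field by (auto simp: fixed_field_n)
  ultimately show "Tr n N ` carrier K = fixed_field N"
    by (intro card_seteq finite_fixed_field)
qed

end

section \<open>Divisors, p-adic valuations and alternating gcd sums\<close>

lemma maximal_p_part:
  fixes p n c :: nat
  assumes p: "Factorial_Ring.prime p" and n: "0 < n" and c: "c dvd n"
  obtains N where "N dvd n" "c dvd N" "coprime (N div c) p"
    "\<And>d. d dvd n \<Longrightarrow> multiplicity p d \<le> multiplicity p c \<Longrightarrow> d dvd N"
proof -
  have unit: "\<not> is_unit p" using p by auto
  obtain m where m: "n = p ^ multiplicity p n * m" "\<not> p dvd m"
    using multiplicity_decompose'[of n p] n unit by auto
  let ?v = "multiplicity p c"
  \<comment> \<open>The largest divisor of \<open>n\<close> with the \<open>p\<close>-adic valuation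
    of \<open>c\<close>: the part of \<open>n\<close> prime to \<open>p\<close>, times the power of
    \<open>p\<close> in \<open>c\<close>.\<close>
  let ?N = "p ^ ?v * m"
  have cN: "d dvd ?N" if "d dvd n" "multiplicity p d \<le> ?v" for d
  proof -
    have "d \<noteq> 0" using that n by auto
    then obtain b where b: "d = p ^ multiplicity p d * b" "\<not> p dvd b"
      using multiplicity_decompose'[of d p] unit by auto
    have "coprime b (p ^ multiplicity p n)"
      using prime_imp_coprime[OF p b(2)] by (simp add: coprime_commute)
    moreover have "b dvd p ^ multiplicity p n * m"
      using b(1) m(1) that(1) by (metis dvd_mult_right)
    ultimately have "b dvd m" by (simp add: coprime_dvd_mult_right_iff)
    moreover have "p ^ multiplicity p d dvd p ^ ?v" using that(2) by (rule le_imp_power_dvd)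
    ultimately show ?thesis using b(1) by (metis mult_dvd_mono)
  qed
  show thesis
  proof (rule that)
    have "?v \<le> multiplicity p n" using c n by (intro dvd_imp_multiplicity_le) auto
    then have "p ^ ?v * m dvd p ^ multiplicity p n * m" by (intro mult_dvd_mono le_imp_power_dvd) auto
    then show "?N dvd n" using m(1) by simp
    show "c dvd ?N" using cN c by simp
    then obtain r where r: "?N = c * r" ..
    have c0: "c \<noteq> 0" using c n by auto
    then obtain b where b: "c = p ^ ?v * b" "\<not> p dvd b"
      using multiplicity_decompose'[of c p] unit by auto
    \<comment> \<open>Cancelling the power of \<open>p\<close> exhibits the quotient
      \<open>r = ?N div c\<close> as a divisor of \<open>m\<close>, hence prime to
      \<open>p\<close>.\<close>
    have "p ^ ?v * m = p ^ ?v * (b * r)" using r b(1) by (metis mult.assoc)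
    then have "m = b * r" using p by (simp add: prime_gt_0_nat)
    then have "\<not> p dvd r" using m(2) by (auto intro: dvd_mult)
    then have "coprime r p" using prime_imp_coprime[OF p] by (metis coprime_commute)
    then show "coprime (?N div c) p" using r c0 by simp
  qed (rule cN)
qed

text \<open>For finite \<open>I\<close> and divisors \<open>d i\<close> of a positive
  \<open>n\<close>, inclusion-exclusion makes this the size of the union of the subgroups of orders
  \<open>d i\<close> in a cyclic group of order \<open>n\<close>. A general index set allows
  induction by \<open>insert\<close>.\<close>

definition gcd_alt_sum :: "'i set \<Rightarrow> ('i \<Rightarrow> nat) \<Rightarrow> int" where
  "gcd_alt_sum I d = (\<Sum>J\<in>Pow I - {{}}. (-1) ^ (card J + 1) * int (Gcd (d ` J)))"

text \<open>The new subsets are \<open>{k}\<close>, which contributes \<open>d k\<close>, and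
  \<open>insert k J\<close> for nonempty \<open>J\<close>; adding \<open>k\<close> to
  \<open>J\<close> reverses the sign and replaces each \<open>d i\<close> by its gcd with
  \<open>d k\<close>.\<close>

lemma gcd_alt_sum_insert:
  assumes fin: "finite I" and k: "k \<notin> I"
  shows "gcd_alt_sum (insert k I) d =
    gcd_alt_sum I d + int (d k) - gcd_alt_sum I (\<lambda>i. gcd (d k) (d i))"
proof -
  let ?t = "\<lambda>d J. (-1) ^ (card J + 1) * int (Gcd (d ` J))"
  let ?g = "\<lambda>i. gcd (d k) (d i)"
  \<comment> \<open>For empty \<open>J\<close> the left side is \<open>d k\<close> and the right
    side 0, so the subset \<open>{k}\<close> is treated separately.\<close>
  have Gcd_insert_image: "gcd (d k) (Gcd (d ` J)) = Gcd (?g ` J)" if "J \<noteq> {}" for J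
  proof (rule dvd_antisym)
    show "gcd (d k) (Gcd (d ` J)) dvd Gcd (?g ` J)"
      by (auto intro!: Gcd_greatest) (meson Gcd_dvd dvd_trans gcd_dvd2 imageI)
    from that obtain j where "j \<in> J" by blast
    then show "Gcd (?g ` J) dvd gcd (d k) (Gcd (d ` J))"
      by (auto intro!: gcd_greatest Gcd_greatest
          intro: dvd_trans[OF Gcd_dvd gcd_dvd1] dvd_trans[OF Gcd_dvd gcd_dvd2])
  qed
  have neg: "?t d (insert k J) = - ?t ?g J" if "J \<in> Pow I - {{}}" for J
  proof -
    have "finite J" "k \<notin> J" "J \<noteq> {}" using that fin k by (auto intro: finite_subset)
    then show ?thesis using Gcd_insert_image[of J] by simp
  qed
  have "Pow (insert k I) - {{}} = (Pow I - {{}}) \<union> insert k ` Pow I"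
    by (auto simp: Pow_insert)
  then have "gcd_alt_sum (insert k I) d = gcd_alt_sum I d + (\<Sum>J\<in>insert k ` Pow I. ?t d J)"
    unfolding gcd_alt_sum_def using fin k by (simp only:) (subst sum.union_disjoint; auto)
  also have "(\<Sum>J\<in>insert k ` Pow I. ?t d J) = (\<Sum>J\<in>Pow I. ?t d (insert k J))"
    using k by (subst sum.reindex) (auto simp: inj_on_def)
  also have "\<dots> = ?t d {k} + (\<Sum>J\<in>Pow I - {{}}. ?t d (insert k J))"
    using fin by (subst sum.remove[of _ "{}"]) auto
  also have "(\<Sum>J\<in>Pow I - {{}}. ?t d (insert k J)) = - gcd_alt_sum I ?g"
    unfolding gcd_alt_sum_def sum_negf[symmetric] using neg by (rule sum.cong[OF refl])
  finally show ?thesis by simp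
qed

text \<open>Nonempty subsets are sorted by size; size one supplies the first sum of
  \<open>lambda_gcd\<close>.\<close>

lemma lambda_gcd_eq_gcd_alt_sum: "lambda_gcd k d = gcd_alt_sum {1..k} d"
proof -
  let ?t = "\<lambda>J. (-1) ^ (card J + 1) * int (Gcd (d ` J))"
  let ?A = "\<lambda>j. {I. I \<subseteq> {1..k} \<and> card I = j}"
  have fin: "finite (?A j)" for j by (rule finite_subset[of _ "Pow {1..k}"]) auto
  have A1: "?A 1 = (\<lambda>i. {i}) ` {1..k}" by (auto simp: card_1_singleton_iff)
  have s1: "(\<Sum>I\<in>?A 1. ?t I) = (\<Sum>i\<in>{1..k}. int (d i))"
    unfolding A1 by (subst sum.reindex) (auto simp: inj_on_def)
  have "Pow {1..k} - {{}} = (\<Union>j\<in>{1..k}. ?A j)"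
  proof (intro equalityI subsetI)
    fix J assume J: "J \<in> Pow {1..k} - {{}}"
    then have "finite J" "card J \<le> k"
      using finite_subset[of J "{1..k}"] card_mono[of "{1..k}" J] by auto
    then show "J \<in> (\<Union>j\<in>{1..k}. ?A j)" using J by (auto simp: Suc_le_eq card_gt_0_iff)
  qed auto
  then have "gcd_alt_sum {1..k} d = (\<Sum>j\<in>{1..k}. \<Sum>I\<in>?A j. ?t I)"
    unfolding gcd_alt_sum_def using fin by (simp only:) (subst sum.UNION_disjoint; auto)
  also have "\<dots> = lambda_gcd k d"
  proof (cases "k = 0")
    case False
    then have "{1..k} = insert 1 {2..k}" by auto
    then have "(\<Sum>j\<in>{1..k}. \<Sum>I\<in>?A j. ?t I) = (\<Sum>I\<in>?A 1. ?t I) + (\<Sum>j\<in>{2..k}. \<Sum>I\<in>?A j. ?t I)"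
      by (simp only:) (subst sum.insert; simp)
    also have "(\<Sum>j\<in>{2..k}. \<Sum>I\<in>?A j. ?t I) =
        (\<Sum>j\<in>{2..k}. (-1) ^ (j + 1) * (\<Sum>I\<in>?A j. int (Gcd (d ` I))))"
      by (simp add: sum_distrib_left)
    finally show ?thesis unfolding s1 lambda_gcd_def .
  qed (simp add: lambda_gcd_def)
  finally show ?thesis by simp
qed

section \<open>Solvability of compatible trace systems\<close>

context finite_field
begin

lemma p_times: "x \<in> carrier K \<Longrightarrow> [p] \<cdot> x = \<zero>"
  using add_pow_ldistr[of \<one> x p] char by simp

text \<open>In characteristic \<open>p\<close> a multiple of \<open>x\<close> depends only on the
  factor modulo \<open>p\<close>, so an inverse of \<open>a\<close> modulo \<open>p\<close> serves
  as \<open>m\<close>.\<close>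

lemma coprime_multiple_inverse:
  assumes "coprime a p"
  obtains m :: nat where "\<And>x. x \<in> carrier K \<Longrightarrow> [a] \<cdot> ([m] \<cdot> x) = x"
proof -
  from assms obtain m where "cong (a * m) 1 p" using cong_solve_coprime_nat[of a p] by auto
  then have "a * m mod p = 1" using p_gt_1 by (simp add: cong_def)
  then have am: "m * a = p * (m * a div p) + 1" by (metis mult.commute mult_div_mod_eq)
  have "[a] \<cdot> ([m] \<cdot> x) = x" if x: "x \<in> carrier K" for x
  proof -
    have "[a] \<cdot> ([m] \<cdot> x) = [(p * (m * a div p) + 1)] \<cdot> x"
      using x am by (simp only: add.nat_pow_pow)
    also have "\<dots> = [(p * (m * a div p))] \<cdot> x \<oplus> x"
      using x by (simp flip: add.nat_pow_mult)
    also have "[(p * (m * a div p))] \<cdot> x = \<zero>"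
      using x p_times by (simp flip: add.nat_pow_pow)
    finally show ?thesis using x by simp
  qed
  then show thesis by (rule that)
qed

lemma fixed_field_multiple: "x \<in> fixed_field m \<Longrightarrow> [(k::nat)] \<cdot> x \<in> fixed_field m"
  by (induction k) (auto simp: fixed_field_add)

lemma Tr_multiple: "x \<in> carrier K \<Longrightarrow> Tr N m ([(k::nat)] \<cdot> x) = [k] \<cdot> Tr N m x"
  by (induction k) (auto simp: Tr_add)

lemma Tr_fixed:
  assumes "x \<in> fixed_field m"
  shows "Tr N m x = [(N div m)] \<cdot> x"
  using assms by (simp add: Tr_def frob_mult_fixed fixed_field_closed add.finprod_const)

text \<open>On \<open>fixed_field c\<close> Frobenius exponents count modulo \<open>c\<close>. There
  the exponents \<open>d * j\<close> run through the multiples of \<open>gcd c d\<close>, each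
  equally often, so \<open>Tr N d x\<close> is a multiple of
  \<open>Tr c (gcd c d) x\<close>.\<close>

lemma Tr_eq_zero_if_Tr_gcd_eq_zero:
  assumes "c dvd N" "d dvd N" "0 < c" "0 < d" and x: "x \<in> fixed_field c"
    and tr: "Tr c (gcd c d) x = \<zero>"
  shows "Tr N d x = \<zero>"
proof -
  define g where "g = gcd c d"
  obtain c' d' where cd: "c = g * c'" "d = g * d'" and cop: "coprime c' d'"
    using gcd_coprime_exists[of c d] assms unfolding g_def by (auto simp: mult.commute)
  have pos: "0 < g" "0 < c'" "0 < d'" using cd assms by auto
  have xc: "x \<in> carrier K" using x by (rule fixed_field_closed)
  have "lcm c d dvd N" using assms by simp
  moreover have "lcm c d = d * c'"
    unfolding cd lcm_mult_left using cop by (simp add: lcm_coprime)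
  \<comment> \<open>As \<open>lcm c d\<close> divides \<open>N\<close>, the number
    \<open>N div d\<close> of summands is a multiple of the period \<open>c'\<close> of
    \<open>d * j\<close> modulo \<open>c\<close>.\<close>
  ultimately obtain t where t: "N = d * (c' * t)" by (metis dvdE mult.assoc)
  let ?h = "\<lambda>j. d' * j mod c'"
  have "inj_on ?h {..<c'}"
  proof (rule inj_onI)
    fix i j assume "i \<in> {..<c'}" "j \<in> {..<c'}" "?h i = ?h j"
    then show "i = j"
      using cop cong_mult_lcancel_nat[of d' c' i j] by (auto simp: cong_def coprime_commute)
  qed
  moreover from this have "?h ` {..<c'} = {..<c'}"
    using pos by (intro endo_inj_surj) auto
  ultimately have "(\<Oplus>j\<in>{..<c'}. frob (g * ?h j) x) = (\<Oplus>j\<in>{..<c'}. frob (g * j) x)"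
    using finsum_reindex[of "\<lambda>j. frob (g * j) x" ?h "{..<c'}"] xc by (simp add: Pi_def)
  also have "\<dots> = \<zero>" using tr cd pos unfolding g_def[symmetric] by (simp add: Tr_def)
  finally have sum: "(\<Oplus>j\<in>{..<c'}. frob (g * ?h j) x) = \<zero>" .
  \<comment> \<open>Since \<open>d * c' = c * d'\<close>, the index \<open>i\<close> drops out
    modulo \<open>c\<close>.\<close>
  have mod: "frob (d * (j + c' * i)) x = frob (g * ?h j) x" for i j
  proof -
    have "d * (j + c' * i) mod c = g * ?h j"
      using cd by (simp add: mult.assoc flip: mult_mod_right) (simp add: algebra_simps)
    then show ?thesis using frob_mod_fixed[OF x] by metis
  qed
  have "Tr N d x = (\<Oplus>j\<in>{..<c' * t}. frob (d * j) x)" using t assms by (simp add: Tr_def)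
  also have "\<dots> = (\<Oplus>i\<in>{..<t}. \<Oplus>j\<in>{..<c'}. frob (d * (j + c' * i)) x)"
    using xc by (intro finsum_mult_nested) simp
  also have "\<dots> = \<zero>" by (simp add: mod sum)
  finally show ?thesis .
qed

theorem trace_system_solvable:
  assumes "finite I"
    and "\<And>i. i \<in> I \<Longrightarrow> 0 < d i \<and> d i dvd n"
    and "\<And>i. i \<in> I \<Longrightarrow> \<beta> i \<in> fixed_field (d i)"
    and "\<And>i j. i \<in> I \<Longrightarrow> j \<in> I \<Longrightarrow>
      Tr (d i) (gcd (d i) (d j)) (\<beta> i) = Tr (d j) (gcd (d i) (d j)) (\<beta> j)"
  shows "\<exists>x\<in>carrier K. \<forall>i\<in>I. Tr n (d i) x = \<beta> i"
  using assms
\<comment> \<open>The rule adds an index \<open>k\<close> whose valuation is at least that of every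
  index in \<open>I\<close>; this makes every \<open>d i\<close> divide the \<open>N\<close>
  below.\<close>
proof (induction I rule: finite_ranking_induct[where f = "\<lambda>i. multiplicity p (d i)"])
  case (insert k I)
  obtain x where x: "x \<in> carrier K" "\<And>i. i \<in> I \<Longrightarrow> Tr n (d i) x = \<beta> i"
    using insert.IH[OF insert.prems] by auto
  let ?c = "d k"
  have c: "0 < ?c" "?c dvd n" using insert.prems(1) by auto
  obtain N where N: "N dvd n" "?c dvd N" "coprime (N div ?c) p"
    and dN: "\<And>d. d dvd n \<Longrightarrow> multiplicity p d \<le> multiplicity p ?c \<Longrightarrow> d dvd N"
    using maximal_p_part[OF prime_p n_pos c(2)] by metis
  have N0: "0 < N" using N(1) n_pos by (auto intro: Nat.gr0I)
  define y where "y = \<beta> k \<ominus> Tr n ?c x"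
  have y: "y \<in> fixed_field ?c"
    unfolding y_def using insert.prems(2) c x
    by (intro fixed_field_minus Tr_in_fixed_field) (auto simp: fixed_field_n)
  \<comment> \<open>Transitivity routes the trace of \<open>x\<close> through F_(q^(d i)), where
    \<open>x\<close> already solves equation \<open>i\<close>; compatibility of
    \<open>\<beta> i\<close> and \<open>\<beta> k\<close> does the rest.\<close>
  have ker: "Tr ?c (gcd ?c (d i)) y = \<zero>" if i: "i \<in> I" for i
  proof -
    let ?g = "gcd ?c (d i)"
    have di: "0 < d i" "d i dvd n" using insert.prems(1) i by auto
    have "Tr ?c ?g y = Tr ?c ?g (\<beta> k) \<ominus> Tr n ?g x"
      unfolding y_def using insert.prems(2)[of k] c x by (simp add: Tr_minus Tr_trans fixed_field_closed)
    also have "Tr n ?g x = Tr (d i) ?g (Tr n (d i) x)"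
      using di x by (simp add: Tr_trans)
    also have "\<dots> = Tr (d i) ?g (\<beta> i)" using x(2) i by simp
    also have "\<dots> = Tr ?c ?g (\<beta> k)" using insert.prems(3)[of k i] i by simp
    finally show ?thesis
      using insert.prems(2)[of k] by (simp add: r_right_minus_eq fixed_field_closed)
  qed
  \<comment> \<open>\<open>[m] \<cdot> y\<close> is \<open>y\<close> divided by
    \<open>N div ?c\<close>, the factor by which \<open>Tr N ?c\<close> multiplies elements of
    \<open>fixed_field ?c\<close>.\<close>
  obtain m :: nat where m: "\<And>x. x \<in> carrier K \<Longrightarrow> [(N div ?c)] \<cdot> ([m] \<cdot> x) = x"
    using coprime_multiple_inverse[OF N(3)] by metis
  have my: "[m] \<cdot> y \<in> fixed_field ?c" using y by (rule fixed_field_multiple)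
  then have "[m] \<cdot> y \<in> Tr n N ` carrier K"
    using fixed_field_mono[OF N(2)] Tr_image[OF N(1)] by auto
  then obtain z where z: "z \<in> carrier K" "Tr n N z = [m] \<cdot> y" by auto
  have "Tr n ?c z = Tr N ?c ([m] \<cdot> y)"
    using Tr_trans[OF N(2,1) N0 z(1)] z(2) by simp
  also have "\<dots> = y" using Tr_fixed[OF my] m y by (simp add: fixed_field_closed)
  finally have zk: "Tr n ?c z = y" .
  have zi: "Tr n (d i) z = \<zero>" if i: "i \<in> I" for i
  proof -
    have di: "0 < d i" "d i dvd N" using insert.prems(1) insert.hyps(2) dN i by auto
    have "Tr ?c (gcd ?c (d i)) ([m] \<cdot> y) = \<zero>"
      using ker[OF i] y by (simp add: Tr_multiple fixed_field_closed)
    then have "Tr N (d i) ([m] \<cdot> y) = \<zero>"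
      using Tr_eq_zero_if_Tr_gcd_eq_zero N(2) di c my by blast
    then show ?thesis using Tr_trans[OF di(2) N(1) N0 z(1)] z(2) by simp
  qed
  have bk: "\<beta> k \<in> carrier K" using insert.prems(2)[of k] by (simp add: fixed_field_closed)
  have k: "Tr n ?c (x \<oplus> z) = \<beta> k"
    using x z bk zk unfolding y_def by (simp add: Tr_add minus_eq a_lcomm r_neg)
  have "Tr n (d i) (x \<oplus> z) = \<beta> i" if "i \<in> I" for i
  proof -
    have "\<beta> i \<in> carrier K" using insert.prems(2)[of i] that by (simp add: fixed_field_closed)
    then show ?thesis using x z zi that by (simp add: Tr_add)
  qed
  with k show ?case using x z by (intro bexI[of _ "x \<oplus> z"]) auto
qed auto

section \<open>Counting the solutions\<close>

definition trace_kernel :: "nat \<Rightarrow> 'i set \<Rightarrow> ('i \<Rightarrow> nat) \<Rightarrow> 'a set" where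
  "trace_kernel M I d = {x \<in> fixed_field M. \<forall>i\<in>I. Tr M (d i) x = \<zero>}"

lemma trace_kernel_closed: "x \<in> trace_kernel M I d \<Longrightarrow> x \<in> carrier K"
  by (auto simp: trace_kernel_def fixed_field_closed)

lemma additive_subgroup_trace_kernel: "additive_subgroup (trace_kernel M I d) K"
proof (rule additive_subgroup.intro, rule add.subgroupI)
  fix x assume x: "x \<in> trace_kernel M I d"
  then have "\<zero> \<ominus> x \<in> trace_kernel M I d"
    using fixed_field_minus[of \<zero> M x]
    by (auto simp: trace_kernel_def Tr_minus r_right_minus_eq dest: fixed_field_closed)
  then show "\<ominus> x \<in> trace_kernel M I d"
    using x by (simp add: minus_eq[of \<zero>] fixed_field_closed[of x M] trace_kernel_def)
next
  show "trace_kernel M I d \<noteq> {}" by (auto simp: trace_kernel_def intro!: exI[of _ \<zero>])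
qed (auto simp: trace_kernel_def Tr_add fixed_field_add fixed_field_closed)

text \<open>Transitivity gives one inclusion. For the other, the system with value \<open>y\<close>
  at \<open>k\<close> and zero elsewhere is solved; it is compatible because \<open>y\<close> lies
  in the kernel on the right.\<close>

lemma Tr_image_trace_kernel:
  assumes M: "M dvd n" and fin: "finite I" and k: "k \<notin> I"
    and d: "\<And>i. i \<in> insert k I \<Longrightarrow> 0 < d i \<and> d i dvd M"
  shows "Tr M (d k) ` trace_kernel M I d = trace_kernel (d k) I (\<lambda>i. gcd (d k) (d i))"
proof
  have M0: "0 < M" using M n_pos by (auto intro: Nat.gr0I)
  show "Tr M (d k) ` trace_kernel M I d \<subseteq> trace_kernel (d k) I (\<lambda>i. gcd (d k) (d i))"
  proof clarify
    fix x assume x: "x \<in> trace_kernel M I d"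
    then have xM: "x \<in> fixed_field M" by (simp add: trace_kernel_def)
    have "Tr (d k) (gcd (d k) (d i)) (Tr M (d k) x) = \<zero>" if i: "i \<in> I" for i
    proof -
      have "Tr (d k) (gcd (d k) (d i)) (Tr M (d k) x) = Tr (d i) (gcd (d k) (d i)) (Tr M (d i) x)"
        using d[of k] d[of i] i xM by (simp add: Tr_trans fixed_field_closed)
      then show ?thesis using x i by (simp add: trace_kernel_def)
    qed
    then show "Tr M (d k) x \<in> trace_kernel (d k) I (\<lambda>i. gcd (d k) (d i))"
      using d[of k] xM by (simp add: trace_kernel_def Tr_in_fixed_field)
  qed
  show "trace_kernel (d k) I (\<lambda>i. gcd (d k) (d i)) \<subseteq> Tr M (d k) ` trace_kernel M I d"
  proof
    fix y assume y: "y \<in> trace_kernel (d k) I (\<lambda>i. gcd (d k) (d i))"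
    let ?b = "\<lambda>i. if i = k then y else \<zero>"
    have "\<exists>x\<in>carrier K. \<forall>i\<in>insert k I. Tr n (d i) x = ?b i"
    proof (rule trace_system_solvable)
      show "0 < d i \<and> d i dvd n" if "i \<in> insert k I" for i
        using d[OF that] M by (auto intro: dvd_trans)
      show "Tr (d i) (gcd (d i) (d j)) (?b i) = Tr (d j) (gcd (d i) (d j)) (?b j)"
        if "i \<in> insert k I" "j \<in> insert k I" for i j
        using that y by (auto simp: trace_kernel_def gcd.commute)
    qed (use fin y in \<open>auto simp: trace_kernel_def\<close>)
    then obtain x where x: "x \<in> carrier K" "\<And>i. i \<in> insert k I \<Longrightarrow> Tr n (d i) x = ?b i"
      by blast
    \<comment> \<open>The system is solved in all of \<open>K\<close>; the trace to
      \<open>fixed_field M\<close> carries the solution into the required field and keeps its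
      traces.\<close>
    have tr: "Tr M (d i) (Tr n M x) = ?b i" if "i \<in> insert k I" for i
      using x(2)[OF that] d[OF that] Tr_trans[OF _ M M0 x(1), of "d i"] by simp
    have "Tr M (d i) (Tr n M x) = \<zero>" if "i \<in> I" for i
      using tr[of i] that k by auto
    moreover have "Tr n M x \<in> fixed_field M"
      using M x by (intro Tr_in_fixed_field) (simp_all add: fixed_field_n)
    ultimately have "Tr n M x \<in> trace_kernel M I d"
      by (simp add: trace_kernel_def)
    moreover have "Tr M (d k) (Tr n M x) = y" using tr[of k] by simp
    ultimately show "y \<in> Tr M (d k) ` trace_kernel M I d" by blast
  qed
qed

text \<open>Comparing image and kernel of \<open>Tr M (d k)\<close> gives the recursion of
  \<open>gcd_alt_sum_insert\<close>. Both \<open>M\<close> and \<open>d\<close> vary because the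
  image lives in \<open>fixed_field (d k)\<close> with the degrees \<open>gcd (d k) (d i)\<close>.
  Real numbers allow division and integer exponents.\<close>

theorem card_trace_kernel:
  assumes "finite I" "M dvd n" "\<And>i. i \<in> I \<Longrightarrow> 0 < d i \<and> d i dvd M"
  shows "real (card (trace_kernel M I d)) = real q powi (int M - gcd_alt_sum I d)"
  using assms
proof (induction I arbitrary: M d rule: finite_induct)
  case empty
  then show ?case
    using card_fixed_field[of M] by (simp add: trace_kernel_def gcd_alt_sum_def)
next
  case (insert k I)
  let ?c = "d k" and ?g = "\<lambda>i. gcd (d k) (d i)"
  have sub: "trace_kernel M I d \<subseteq> carrier K"
    by (auto simp: trace_kernel_closed)
  have "card (trace_kernel M I d) =
      card (Tr M ?c ` trace_kernel M I d) * card {x \<in> trace_kernel M I d. Tr M ?c x = \<zero>}"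
    using sub by (intro card_eq_card_image_times_card_kernel additive_subgroup_trace_kernel)
      (auto simp: Tr_add trace_kernel_closed intro: finite_subset[OF sub finite_carrier])
  also have "Tr M ?c ` trace_kernel M I d = trace_kernel ?c I ?g"
    using insert by (intro Tr_image_trace_kernel) auto
  also have "{x \<in> trace_kernel M I d. Tr M ?c x = \<zero>} = trace_kernel M (insert k I) d"
    by (auto simp: trace_kernel_def)
  finally have "real (card (trace_kernel M I d)) =
      real (card (trace_kernel ?c I ?g)) * real (card (trace_kernel M (insert k I) d))"
    by simp
  also have "real (card (trace_kernel M I d)) = real q powi (int M - gcd_alt_sum I d)"
    using insert.prems by (intro insert.IH) auto
  also have "real (card (trace_kernel ?c I ?g)) = real q powi (int ?c - gcd_alt_sum I ?g)"
    using insert.prems by (intro insert.IH) (auto intro: dvd_trans)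
  finally have "real (card (trace_kernel M (insert k I) d)) =
      real q powi (int M - gcd_alt_sum I d) / real q powi (int ?c - gcd_alt_sum I ?g)"
    using p_gt_1 by (simp add: field_simps)
  also have "\<dots> = real q powi ((int M - gcd_alt_sum I d) - (int ?c - gcd_alt_sum I ?g))"
    using p_gt_1 by (subst power_int_diff) auto
  also have "(int M - gcd_alt_sum I d) - (int ?c - gcd_alt_sum I ?g) =
      int M - gcd_alt_sum (insert k I) d"
    using insert.hyps by (simp add: gcd_alt_sum_insert)
  finally show ?case .
qed

theorem card_trace_solutions:
  assumes fin: "finite I"
    and d: "\<And>i. i \<in> I \<Longrightarrow> 0 < d i \<and> d i dvd n"
    and \<beta>: "\<And>i. i \<in> I \<Longrightarrow> \<beta> i \<in> fixed_field (d i)"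
    and compat: "\<And>i j. i \<in> I \<Longrightarrow> j \<in> I \<Longrightarrow>
      Tr (d i) (gcd (d i) (d j)) (\<beta> i) = Tr (d j) (gcd (d i) (d j)) (\<beta> j)"
  shows "real (card {x \<in> carrier K. \<forall>i\<in>I. Tr n (d i) x = \<beta> i}) =
    real q powi (int n - gcd_alt_sum I d)"
proof -
  let ?S = "{x \<in> carrier K. \<forall>i\<in>I. Tr n (d i) x = \<beta> i}"
  obtain a where a: "a \<in> carrier K" "\<And>i. i \<in> I \<Longrightarrow> Tr n (d i) a = \<beta> i"
    using trace_system_solvable[of I d \<beta>, OF fin d \<beta> compat] by blast
  have ker: "trace_kernel n I d = {x \<in> carrier K. \<forall>i\<in>I. Tr n (d i) x = \<zero>}"
    by (simp add: trace_kernel_def fixed_field_n)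
  have b: "\<beta> i \<in> carrier K" if "i \<in> I" for i
    using \<beta>[OF that] by (rule fixed_field_closed)
  have "bij_betw (\<lambda>x. x \<oplus> a) (trace_kernel n I d) ?S"
  proof (rule bij_betw_byWitness[where f' = "\<lambda>x. x \<ominus> a"])
    show "(\<lambda>x. x \<oplus> a) ` trace_kernel n I d \<subseteq> ?S"
      using a b by (auto simp: ker Tr_add)
    show "(\<lambda>x. x \<ominus> a) ` ?S \<subseteq> trace_kernel n I d"
      using a b by (auto simp: ker Tr_minus r_right_minus_eq)
  qed (use a in \<open>auto simp: ker minus_eq a_assoc r_neg l_neg\<close>)
  then have "card ?S = card (trace_kernel n I d)" by (rule bij_betw_same_card[symmetric])
  then show ?thesis using card_trace_kernel[OF fin dvd_refl d] by simp
qed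

section \<open>Passage from abstract subfields to fixed fields\<close>

lemma subfield_subset_fixed_field:
  assumes S: "subfield S K" and card: "card S = q ^ m"
  shows "S \<subseteq> fixed_field m"
proof
  fix x assume x: "x \<in> S"
  interpret S: field "K\<lparr>carrier := S\<rparr>" using S by (rule subfield_iff(2))
  have sub: "S \<subseteq> carrier K" using S by (rule subfieldE(3))
  \<comment> \<open>Fermat's little theorem inside the field \<open>S\<close> of
    \<open>q ^ m\<close> elements is the Frobenius equation for \<open>m\<close>.\<close>
  then have "x [^] card S = x"
    using S.pow_card_eq_self[of x] x finite_subset[OF sub finite_carrier] nat_pow_consistent by simp
  then show "x \<in> fixed_field m" using x sub card by (auto simp: fixed_field_def frob_def)
qed

end

theorem theorem4p1:
  fixes K :: "('a, 'b) ring_scheme"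
    and F :: "nat \<Rightarrow> 'a set"
    and q n k :: nat
    and d :: "nat \<Rightarrow> nat"
    and \<beta> :: "nat \<Rightarrow> 'a"
  assumes "primepow q"
    and "n > 1"
    and "k \<ge> 1"
    and "field K"
    and "card (carrier K) = q ^ n"
    and "\<And>i. i \<in> {1..k} \<Longrightarrow> d i > 0 \<and> d i dvd n"
    and "inj_on d {1..k}"
    and "\<And>i. i \<in> {1..k} \<Longrightarrow> subfield (F (d i)) K \<and> card (F (d i)) = q ^ d i"
    and "\<And>i. i \<in> {1..k} \<Longrightarrow> \<beta> i \<in> F (d i)"
    and "\<And>i j. 1 \<le> i \<Longrightarrow> i < j \<Longrightarrow> j \<le> k \<Longrightarrow>
           trace_map K q (d i) (gcd (d i) (d j)) (\<beta> i) =
           trace_map K q (d j) (gcd (d i) (d j)) (\<beta> j)"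
  shows "real (card {x \<in> carrier K. \<forall>i\<in>{1..k}. trace_map K q n (d i) x = \<beta> i}) =
           real q powi (int n - lambda_gcd k d)"
proof -
  obtain p e where pe: "Factorial_Ring.prime p" "0 < e" "q = p ^ e"
    using assms(1) by (auto simp: primepow_def)
  interpret finite_field K p e n
    using pe assms(2,4,5) by (simp add: finite_field_def finite_field_axioms_def)
  \<comment> \<open>The hypothesis covers \<open>i < j\<close>; symmetry of the gcd gives
    \<open>j < i\<close>, and \<open>i = j\<close> is trivial.\<close>
  have compat: "Tr (d i) (gcd (d i) (d j)) (\<beta> i) = Tr (d j) (gcd (d i) (d j)) (\<beta> j)"
    if "i \<in> {1..k}" "j \<in> {1..k}" for i j
    using that assms(10)[of i j] assms(10)[of j i] pe(3)
    by (cases i j rule: linorder_cases) (auto simp: gcd.commute)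
  show ?thesis
    unfolding lambda_gcd_eq_gcd_alt_sum pe(3)
  proof (rule card_trace_solutions)
    show "\<beta> i \<in> fixed_field (d i)" if "i \<in> {1..k}" for i
      using subfield_subset_fixed_field[of "F (d i)" "d i"] assms(8,9)[OF that] pe(3) by auto
  qed (use assms(6) compat in auto)
qed

end
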